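(* Let $G$ be an abelian (not necessarily finite) group with Cayley table $L$ (rows and columns indexed by $G$, cell $(g,h)$ containing $g+h$). Let $m$ be a positive integer and let $R$ be the submatrix of $L$ with rows indexed by a finite set $X\subseteq G$ and columns indexed by a finite set $Y\subseteq G$, where $|X|=\alpha m$ and $|Y|=\beta m$ with $\alpha>\frac12$ and $\beta>\frac23$, and suppose $R$ contains exactly $m$ distinct symbols. Then $R$ is contained in an $m\times m$ subsquare of $L$.
   Context: An $m\times m$ subsquare of $L$ is a submatrix of $L$, with rows indexed by some $X'\subseteq G$ and columns indexed by some $Y'\subseteq G$, $|X'|=|Y'|=m$, which is itself a Latin square of order $m$ (i.e., contains exactly $m$ distinct symbols). $R$ is contained in it if $X\subseteq X'$ and $Y\subseteq Y'$. *)

theory Defs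
  imports Complex_Main
begin

text \<open>
  A matrix is a function of a row index and a column index. The submatrix of \<open>M\<close> with
  rows \<open>X\<close> and columns \<open>Y\<close> is represented by \<open>M\<close> together with the index sets \<open>X\<close> and \<open>Y\<close>.
\<close>

definition cayley_table :: "'a::ab_group_add \<Rightarrow> 'a \<Rightarrow> 'a" where
  "cayley_table g h = g + h"

definition symbols :: "('r \<Rightarrow> 'c \<Rightarrow> 's) \<Rightarrow> 'r set \<Rightarrow> 'c set \<Rightarrow> 's set" where
  "symbols M X Y = {M x y | x y. x \<in> X \<and> y \<in> Y}"

text \<open>
  For submatrices of a Cayley table the last two conditions follow from the others; in general
  they are what distinguishes a Latin square from an array with \<open>m\<close> symbols.
\<close>

definition latin_square :: "nat \<Rightarrow> ('r \<Rightarrow> 'c \<Rightarrow> 's) \<Rightarrow> 'r set \<Rightarrow> 'c set \<Rightarrow> bool" where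
  "latin_square m M X Y \<longleftrightarrow>
     finite X \<and> finite Y \<and> card X = m \<and> card Y = m \<and>
     finite (symbols M X Y) \<and> card (symbols M X Y) = m \<and>
     (\<forall>x\<in>X. \<forall>s\<in>symbols M X Y. \<exists>!y. y \<in> Y \<and> M x y = s) \<and>
     (\<forall>y\<in>Y. \<forall>s\<in>symbols M X Y. \<exists>!x. x \<in> X \<and> M x y = s)"

end

theory Submission
  imports Defs
begin

text \<open>
  Write \<open>C = X + Y\<close>, with \<open>card C = m\<close>. Two translates of \<open>X\<close> (or of \<open>Y\<close>) inside \<open>C\<close> must meet, so
  \<open>X - X = Y - Y\<close>; call this set \<open>H\<close>. Every \<open>d \<in> H\<close> has at least \<open>2 * card Y - m > card Y / 2\<close>
  representations as a difference of elements of \<open>Y\<close>, so for \<open>d, e \<in> H\<close> some \<open>y\<close> has both \<open>y - d\<close> and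
  \<open>y - e\<close> in \<open>Y\<close>; hence \<open>H\<close> is a subgroup, and \<open>X\<close>, \<open>Y\<close>, \<open>C\<close> lie in cosets of \<open>H\<close>. Suppose
  the complement \<open>N\<close> of \<open>C\<close> in its coset contains \<open>n\<^sub>0\<close>. The sets \<open>n - Y\<close> for \<open>n \<in> N\<close> avoid \<open>X\<close>
  within the coset of \<open>X\<close>, so the differences \<open>n - n\<^sub>0\<close> have many more representations than the
  bound above. Summing the numbers of representations over \<open>H\<close> then exceeds \<open>(card Y)\<^sup>2\<close>.
\<close>

section \<open>Difference sets, representation counts and translates\<close>

definition differences :: "'a::ab_group_add set \<Rightarrow> 'a set" where
  "differences A = {x - y | x y. x \<in> A \<and> y \<in> A}"

definition diff_reps :: "'a::ab_group_add set \<Rightarrow> 'a \<Rightarrow> nat" where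
  "diff_reps B d = card {b \<in> B. b - d \<in> B}"

text \<open>This is the translate of \<open>H\<close> by \<open>a\<close>. It makes sense for any
  set \<open>H\<close>, so that it can be used before \<open>H\<close> is known to be a
  subgroup.\<close>

definition diff_coset :: "'a::ab_group_add set \<Rightarrow> 'a \<Rightarrow> 'a set" where
  "diff_coset H a = {x. x - a \<in> H}"

lemma finite_differences: "finite A \<Longrightarrow> finite (differences A)"
  unfolding differences_def by (rule finite_image_set2) auto

lemma diff_coset_eq_image: "diff_coset H a = (\<lambda>h. a + h) ` H"
proof -
  have "x \<in> (\<lambda>h. a + h) ` H" if "x - a \<in> H" for x
    using that by (intro image_eqI[of _ _ "x - a"]) auto
  then show ?thesis
    by (auto simp: diff_coset_def)
qed

lemma card_diff_coset: "card (diff_coset H a) = card H"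
  unfolding diff_coset_eq_image by (intro card_image) (auto simp: inj_on_def)

lemma finite_diff_coset: "finite H \<Longrightarrow> finite (diff_coset H a)"
  unfolding diff_coset_eq_image by simp

lemma diff_repsD:
  assumes "diff_reps B d > 0"
  shows "d \<in> differences B"
proof -
  from assms have "{b \<in> B. b - d \<in> B} \<noteq> {}"
    unfolding diff_reps_def using card_gt_0_iff by blast
  then obtain b where "b \<in> B" "b - d \<in> B"
    by blast
  moreover have "d = b - (b - d)"
    by simp
  ultimately show ?thesis
    unfolding differences_def by blast
qed

section \<open>Bounds and total for representation counts\<close>

lemma card_overlap_of_images:
  assumes "finite S" "finite B" "inj_on f B" "inj_on g B" "f ` B \<subseteq> S" "g ` B \<subseteq> S"
  shows "2 * card B \<le> card S + card {b \<in> B. f b \<in> g ` B}"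
proof -
  have "card (f ` B \<inter> g ` B) = card (f ` {b \<in> B. f b \<in> g ` B})"
    by (rule arg_cong[of _ _ card]) auto
  also have "\<dots> = card {b \<in> B. f b \<in> g ` B}"
    using assms(3) by (intro card_image) (auto simp: inj_on_def)
  finally have "card (f ` B) + card (g ` B) = card (f ` B \<union> g ` B) + card {b \<in> B. f b \<in> g ` B}"
    using card_Un_Int[of "f ` B" "g ` B"] assms(2) by simp
  moreover have "card (f ` B \<union> g ` B) \<le> card S"
    using assms by (intro card_mono) auto
  ultimately show ?thesis
    using assms(3,4) by (simp add: card_image)
qed

text \<open>The two translates of \<open>B\<close> overlap in \<open>S\<close> by
  inclusion-exclusion, and \<open>u + b = v + b'\<close> says exactly that
  \<open>b - (v - u) = b'\<close>, so each common point is a representation of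
  \<open>v - u\<close>.\<close>

lemma diff_reps_ge_translates:
  fixes B :: "'a::ab_group_add set"
  assumes "finite S" "finite B" "\<And>b. b \<in> B \<Longrightarrow> u + b \<in> S" "\<And>b. b \<in> B \<Longrightarrow> v + b \<in> S"
  shows "2 * card B \<le> card S + diff_reps B (v - u)"
proof -
  have "{b \<in> B. u + b \<in> (\<lambda>b. v + b) ` B} = {b \<in> B. b - (v - u) \<in> B}"
    by (force simp: image_iff algebra_simps)
  then show ?thesis
    using card_overlap_of_images[of S B "\<lambda>b. u + b" "\<lambda>b. v + b"] assms
    by (auto simp: diff_reps_def inj_on_def)
qed

text \<open>Reflected copies of \<open>B\<close> count representations too, since
  \<open>u - b = v - b'\<close> means \<open>b - (u - v) = b'\<close>. The gain is that
  \<open>S\<close> may then be a set smaller than the sumset.\<close>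

lemma diff_reps_ge_reflections:
  fixes B :: "'a::ab_group_add set"
  assumes "finite S" "finite B" "\<And>b. b \<in> B \<Longrightarrow> u - b \<in> S" "\<And>b. b \<in> B \<Longrightarrow> v - b \<in> S"
  shows "2 * card B \<le> card S + diff_reps B (u - v)"
proof -
  have "{b \<in> B. u - b \<in> (\<lambda>b. v - b) ` B} = {b \<in> B. b - (u - v) \<in> B}"
  proof -
    have "u - b \<in> (\<lambda>b. v - b) ` B \<longleftrightarrow> b - (u - v) \<in> B" for b
    proof
      assume "b - (u - v) \<in> B"
      then show "u - b \<in> (\<lambda>b. v - b) ` B"
        by (rule image_eqI[rotated]) (simp add: algebra_simps)
    next
      assume "u - b \<in> (\<lambda>b. v - b) ` B"
      then obtain c where "c \<in> B" "u - b = v - c"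
        by blast
      moreover from this(2) have "b - (u - v) = c"
        by (simp add: algebra_simps)
      ultimately show "b - (u - v) \<in> B"
        by simp
    qed
    then show ?thesis
      by simp
  qed
  then show ?thesis
    using card_overlap_of_images[of S B "\<lambda>b. u - b" "\<lambda>b. v - b"] assms
    by (auto simp: diff_reps_def inj_on_def)
qed

text \<open>Double counting of the pairs in \<open>B\<close> by their difference: for fixed
  \<open>b\<close>, the map taking \<open>c\<close> to \<open>b - c\<close> matches \<open>B\<close>
  with the differences \<open>d\<close> such that \<open>b - d\<close> is in
  \<open>B\<close>.\<close>

lemma sum_diff_reps:
  assumes "finite B"
  shows "(\<Sum>d\<in>differences B. diff_reps B d) = card B * card B"
proof -
  have *: "{d \<in> differences B. b - d \<in> B} = (\<lambda>c. b - c) ` B" if "b \<in> B" for b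
  proof
    show "{d \<in> differences B. b - d \<in> B} \<subseteq> (\<lambda>c. b - c) ` B"
    proof
      fix d assume "d \<in> {d \<in> differences B. b - d \<in> B}"
      then show "d \<in> (\<lambda>c. b - c) ` B"
        by (intro image_eqI[of _ _ "b - d"]) auto
    qed
  qed (use that in \<open>auto simp: differences_def\<close>)
  have "(\<Sum>d\<in>differences B. diff_reps B d)
      = (\<Sum>d\<in>differences B. \<Sum>b\<in>B. if b - d \<in> B then 1 else 0)"
    using assms by (intro sum.cong) (simp_all add: diff_reps_def sum.If_cases Int_def)
  also have "\<dots> = (\<Sum>b\<in>B. \<Sum>d\<in>differences B. if b - d \<in> B then 1 else 0)"
    by (rule sum.swap)
  also have "\<dots> = (\<Sum>b\<in>B. card {d \<in> differences B. b - d \<in> B})"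
    using finite_differences[OF assms]
    by (intro sum.cong) (simp_all add: sum.If_cases Int_def)
  also have "\<dots> = (\<Sum>b\<in>B. card B)"
    by (intro sum.cong) (simp_all add: * card_image inj_on_def)
  finally show ?thesis
    by simp
qed

section \<open>The numerical contradiction\<close>

text \<open>Here \<open>a\<close>, \<open>b\<close>, \<open>m\<close>, \<open>h\<close> stand for
  the sizes of \<open>A\<close>, \<open>B\<close>, the sumset and \<open>H\<close>. The two counting
  hypotheses confine the number \<open>c = h - m\<close> of missing elements to incompatible
  ranges.\<close>

lemma dense_counting_contradiction:
  fixes a b m h :: real
  assumes "0 < m" "m < h" "m < 2 * a" "2 * m < 3 * b" "a + b \<le> h"
    and uniform: "h * (2 * b - m) \<le> b * b"
    and refined: "(h - m) * (2 * b - (h - a)) + m * (2 * b - m) \<le> b * b"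
  shows False
proof -
  define c where "c = h - m"
  have c: "0 < c" "m = h - c"
    using assms by (auto simp: c_def)
  have pos: "0 < b" "0 < h" "0 < a"
    using assms by linarith+
  \<comment> \<open>From \<open>2 * m < 3 * b\<close> the uniform bound \<open>2 * b - m\<close>
    exceeds \<open>b / 2\<close>.\<close>
  have "h * (b / 2) < h * (2 * b - m)"
    using assms pos by (intro mult_strict_left_mono) linarith+
  with uniform have "b * (h / 2) < b * b"
    by (simp add: algebra_simps)
  then have hb: "h / 2 < b"
    using pos by (simp only: mult_less_cancel_left_pos)
  have "h * c \<le> (h - b) * (h - b)"
    using uniform by (simp add: c(2) algebra_simps)
  also have "\<dots> < (h / 2) * (h / 2)"
    using hb assms pos by (intro mult_strict_mono) linarith+
  also have "\<dots> = h * (h / 4)"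
    by simp
  finally have c4: "c < h / 4"
    using pos by (simp only: mult_less_cancel_left_pos)
  \<comment> \<open>The densities give
    \<open>h \<ge> a + b > m / 2 + 2 * m / 3 = 7 * m / 6\<close>.\<close>
  have c7: "h < 7 * c"
    using assms c by linarith
  have "c * (3 / 2 * (h - c)) \<le> c * (h - c + a)"
    using assms(3) c by (intro mult_left_mono) (simp_all add: field_simps)
  also have "\<dots> \<le> (h - b) * (h - b)"
    using refined by (simp add: c(2) algebra_simps)
  also have "\<dots> < ((h + 2 * c) / 3) * ((h + 2 * c) / 3)"
    using assms(3-5) c pos by (intro mult_strict_mono) (simp_all add: field_simps)
  \<comment> \<open>Clearing denominators leaves
    \<open>2 * h * h - 19 * h * c + 35 * c * c > 0\<close>, which fails for \<open>c\<close>
    strictly between \<open>h / 7\<close> and \<open>2 * h / 5\<close>; \<open>c4\<close> and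
    \<open>c7\<close> put \<open>c\<close> there.\<close>
  finally have "0 < (h - 7 * c) * (2 * h - 5 * c)"
    by (simp add: field_simps)
  moreover have "(h - 7 * c) * (2 * h - 5 * c) < 0"
    using c4 c7 c pos by (intro mult_neg_pos) linarith+
  ultimately show False
    by simp
qed

section \<open>The sumset fills a coset\<close>

lemma sumset_is_coset:
  fixes A B :: "'a::ab_group_add set"
  defines "C \<equiv> symbols cayley_table A B" and "H \<equiv> differences A"
  assumes fin: "finite A" "finite B"
    and dense: "card C < 2 * card A" "2 * card C < 3 * card B"
    and a0: "a0 \<in> A" and b0: "b0 \<in> B"
  shows "\<And>x y. x \<in> H \<Longrightarrow> y \<in> H \<Longrightarrow> x - y \<in> H"
    and "A \<subseteq> diff_coset H a0" and "B \<subseteq> diff_coset H b0" and "C = diff_coset H (a0 + b0)"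
proof -
  have finC: "finite C"
    unfolding C_def symbols_def using fin by (intro finite_image_set2) auto
  have finH: "finite H"
    unfolding H_def using fin(1) by (rule finite_differences)
  have CI: "a + b \<in> C" if "a \<in> A" "b \<in> B" for a b
    using that unfolding C_def symbols_def cayley_table_def by blast
  have reps: "2 * card B \<le> card C + diff_reps B d" if d: "d \<in> H" for d
  proof -
    obtain u v where "u \<in> A" "v \<in> A" "d = v - u"
      using d unfolding H_def differences_def by blast
    then show ?thesis
      using diff_reps_ge_translates[OF finC fin(2), of u v] CI by blast
  qed
  have HB: "H = differences B"
  proof
    show "H \<subseteq> differences B"
    proof
      fix d assume "d \<in> H"
      from reps[OF this] dense have "diff_reps B d > 0"
        by linarith
      then show "d \<in> differences B"
        by (rule diff_repsD)
    qed
    show "differences B \<subseteq> H"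
    proof
      fix d assume "d \<in> differences B"
      then obtain u v where uv: "u \<in> B" "v \<in> B" "d = v - u"
        unfolding differences_def by blast
      then have "2 * card A \<le> card C + diff_reps A d"
        using diff_reps_ge_translates[OF finC fin(1), of u v] CI by (simp add: add.commute)
      with dense have "diff_reps A d > 0"
        by linarith
      then show "d \<in> H"
        unfolding H_def by (rule diff_repsD)
    qed
  qed
  show diff: "x - y \<in> H" if xy: "x \<in> H" "y \<in> H" for x y
  proof -
    let ?P = "{b \<in> B. b - x \<in> B}" and ?Q = "{b \<in> B. b - y \<in> B}"
    \<comment> \<open>Each of the two sets has at least \<open>2 * card B - card C\<close> elements,
      more than half of \<open>B\<close>.\<close>
    have "card ?P + card ?Q > card B"
      using reps[OF xy(1)] reps[OF xy(2)] dense unfolding diff_reps_def by linarith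
    moreover have "card (?P \<union> ?Q) \<le> card B"
      using fin by (intro card_mono) auto
    moreover have "card ?P + card ?Q = card (?P \<union> ?Q) + card (?P \<inter> ?Q)"
      using fin by (intro card_Un_Int) auto
    ultimately have "?P \<inter> ?Q \<noteq> {}"
      by (intro notI) simp
    then obtain b where "b - x \<in> B" "b - y \<in> B"
      by blast
    moreover have "x - y = (b - y) - (b - x)"
      by simp
    ultimately show ?thesis
      unfolding HB differences_def by blast
  qed
  have zero: "0 \<in> H"
    unfolding H_def differences_def using a0 by force
  have add: "x + y \<in> H" if "x \<in> H" "y \<in> H" for x y
    using diff[OF that(1) diff[OF zero that(2)]] by simp
  show A: "A \<subseteq> diff_coset H a0"
    unfolding H_def diff_coset_def differences_def using a0 by blast
  show B: "B \<subseteq> diff_coset H b0"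
    unfolding HB diff_coset_def differences_def using b0 by blast
  let ?K = "diff_coset H (a0 + b0)"
  have finK: "finite ?K"
    using finH by (rule finite_diff_coset)
  have CK: "C \<subseteq> ?K"
  proof
    fix x assume "x \<in> C"
    then obtain a b where ab: "a \<in> A" "b \<in> B" "x = a + b"
      unfolding C_def symbols_def cayley_table_def by blast
    then have "a - a0 \<in> H" "b - b0 \<in> H"
      using A B unfolding diff_coset_def by blast+
    then have "(a - a0) + (b - b0) \<in> H"
      by (rule add)
    then show "x \<in> ?K"
      by (simp add: ab diff_coset_def algebra_simps)
  qed
  show "C = ?K"
  proof (rule ccontr)
    assume "C \<noteq> ?K"
    with CK obtain n0 where n0: "n0 \<in> ?K - C"
      by blast
    have less: "card C < card H"
      using psubset_card_mono[OF finK] CK \<open>C \<noteq> ?K\<close> card_diff_coset[of H "a0 + b0"] by auto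
    let ?S = "diff_coset H a0 - A"
    have finS: "finite ?S"
      using finite_diff_coset[OF finH] by blast
    have cardS: "card ?S = card H - card A"
      using card_Diff_subset[OF fin(1) A] by (simp add: card_diff_coset)
    have AH: "card A \<le> card H"
      using card_mono[OF finite_diff_coset[OF finH] A] by (simp add: card_diff_coset)
    \<comment> \<open>If \<open>n - b\<close> were in \<open>A\<close>, then
      \<open>n = (n - b) + b\<close> would lie in \<open>C\<close>. So \<open>?S\<close> can replace
      \<open>C\<close> as the container of copies of \<open>B\<close>.\<close>
    have refl: "n - b \<in> ?S" if n: "n \<in> ?K - C" and b: "b \<in> B" for n b
    proof -
      have "n - (a0 + b0) \<in> H" "b - b0 \<in> H"
        using n b B unfolding diff_coset_def by blast+
      then have "(n - (a0 + b0)) - (b - b0) \<in> H"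
        by (rule diff)
      then have "n - b \<in> diff_coset H a0"
        by (simp add: diff_coset_def algebra_simps)
      moreover have "n - b \<notin> A"
        using CI[of "n - b" b] n b by auto
      ultimately show ?thesis
        by blast
    qed
    have "card B = card ((\<lambda>b. n0 - b) ` B)"
      by (intro card_image[symmetric]) (auto simp: inj_on_def)
    also have "\<dots> \<le> card ?S"
      using refl[OF n0] by (intro card_mono[OF finS]) blast
    finally have BH: "card A + card B \<le> card H"
      using cardS AH by linarith
    \<comment> \<open>Shifting the missing elements by \<open>n0\<close> moves them into
      \<open>H\<close>; these \<open>card H - card C\<close> differences get the stronger bound from
      reflections.\<close>
    let ?D = "(\<lambda>n. n - n0) ` (?K - C)"
    have cardD: "card ?D = card H - card C"
      using card_Diff_subset[OF finC CK]
      by (subst card_image) (auto simp: inj_on_def card_diff_coset)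
    have DH: "?D \<subseteq> H"
    proof
      fix d assume "d \<in> ?D"
      then obtain n where n: "n - (a0 + b0) \<in> H" "d = n - n0"
        unfolding diff_coset_def by blast
      have "n0 - (a0 + b0) \<in> H"
        using n0 unfolding diff_coset_def by blast
      with n(1) have "(n - (a0 + b0)) - (n0 - (a0 + b0)) \<in> H"
        by (rule diff)
      then show "d \<in> H"
        using n by simp
    qed
    have uniform: "2 * real (card B) - real (card C) \<le> real (diff_reps B d)" if "d \<in> H" for d
      using reps[OF that] by linarith
    have refined: "2 * real (card B) - (real (card H) - real (card A)) \<le> real (diff_reps B d)"
      if d: "d \<in> ?D" for d
    proof -
      obtain n where "n \<in> ?K - C" "d = n - n0"
        using d by blast
      then have "2 * card B \<le> card ?S + diff_reps B d"
        using diff_reps_ge_reflections[OF finS fin(2), of n n0] refl n0 by blast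
      then show ?thesis
        using cardS AH by linarith
    qed
    have total: "(\<Sum>d\<in>H. real (diff_reps B d)) = real (card B) * real (card B)"
      using arg_cong[OF sum_diff_reps[OF fin(2)], of real] by (simp add: HB)
    have "real (card H) * (2 * real (card B) - real (card C)) \<le> real (card B) * real (card B)"
      using sum_mono[of H "\<lambda>_. 2 * real (card B) - real (card C)" "\<lambda>d. real (diff_reps B d)"]
        uniform total by simp
    \<comment> \<open>The total over \<open>H\<close> is split into \<open>?D\<close>, with the
      reflection bound, and the other \<open>card C\<close> differences, with the uniform
      bound.\<close>
    moreover have "(real (card H) - real (card C)) * (2 * real (card B) - (real (card H) - real (card A)))
        + real (card C) * (2 * real (card B) - real (card C)) \<le> real (card B) * real (card B)"
    proof -
      have "card (H - ?D) = card C"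
        using card_Diff_subset[OF finite_subset[OF DH finH] DH] cardD less by simp
      then have "real (card C) * (2 * real (card B) - real (card C))
          \<le> (\<Sum>d\<in>H - ?D. real (diff_reps B d))"
        using sum_mono[of "H - ?D" "\<lambda>_. 2 * real (card B) - real (card C)"
            "\<lambda>d. real (diff_reps B d)"] uniform by simp
      moreover have "(real (card H) - real (card C))
          * (2 * real (card B) - (real (card H) - real (card A))) \<le> (\<Sum>d\<in>?D. real (diff_reps B d))"
        using sum_mono[of ?D "\<lambda>_. 2 * real (card B) - (real (card H) - real (card A))"
            "\<lambda>d. real (diff_reps B d)"] refined cardD less by (simp add: of_nat_diff)
      ultimately show ?thesis
        using sum.subset_diff[OF DH finH, of "\<lambda>d. real (diff_reps B d)"] total by linarith
    qed
    moreover have "0 < card C"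
      using CI[OF a0 b0] finC card_gt_0_iff by blast
    ultimately show False
      using dense_counting_contradiction[of "real (card C)" "real (card H)" "real (card A)"
          "real (card B)"] less dense BH by linarith
  qed
qed

section \<open>Cosets of a finite subgroup span a subsquare\<close>

lemma latin_square_cosets:
  fixes H :: "'a::ab_group_add set"
  assumes fin: "finite H" and zero: "0 \<in> H"
    and diff: "\<And>x y. x \<in> H \<Longrightarrow> y \<in> H \<Longrightarrow> x - y \<in> H"
  shows "latin_square (card H) cayley_table (diff_coset H a) (diff_coset H b)"
proof -
  let ?S = "symbols cayley_table (diff_coset H a) (diff_coset H b)"
  have add: "x + y \<in> H" if "x \<in> H" "y \<in> H" for x y
    using diff[OF that(1) diff[OF zero that(2)]] by simp
  \<comment> \<open>The only solution of \<open>x + y = s\<close> is \<open>y = s - x\<close>, and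
    it lies in the right coset because \<open>s - x - b = (s - (a + b)) - (x - a)\<close>.\<close>
  have left: "s - x \<in> diff_coset H b" if "x \<in> diff_coset H a" "s \<in> diff_coset H (a + b)" for x s
    using diff[of "s - (a + b)" "x - a"] that by (simp add: diff_coset_def algebra_simps)
  have right: "s - y \<in> diff_coset H a" if "y \<in> diff_coset H b" "s \<in> diff_coset H (a + b)" for y s
    using diff[of "s - (a + b)" "y - b"] that by (simp add: diff_coset_def algebra_simps)
  have S: "?S = diff_coset H (a + b)"
  proof
    show "?S \<subseteq> diff_coset H (a + b)"
    proof
      fix s assume "s \<in> ?S"
      then obtain x y where "x - a \<in> H" "y - b \<in> H" "s = x + y"
        unfolding symbols_def cayley_table_def diff_coset_def by blast
      then show "s \<in> diff_coset H (a + b)"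
        using add[of "x - a" "y - b"] by (simp add: diff_coset_def algebra_simps)
    qed
    show "diff_coset H (a + b) \<subseteq> ?S"
    proof
      fix s assume s: "s \<in> diff_coset H (a + b)"
      have a: "a \<in> diff_coset H a"
        using zero by (simp add: diff_coset_def)
      have "s = cayley_table a (s - a)"
        by (simp add: cayley_table_def)
      with a left[OF a s] show "s \<in> ?S"
        unfolding symbols_def by blast
    qed
  qed
  have "\<exists>!y. y \<in> diff_coset H b \<and> cayley_table x y = s"
    if "x \<in> diff_coset H a" "s \<in> diff_coset H (a + b)" for x s
    using left[OF that] by (intro ex1I[of _ "s - x"]) (auto simp: cayley_table_def)
  moreover have "\<exists>!x. x \<in> diff_coset H a \<and> cayley_table x y = s"
    if "y \<in> diff_coset H b" "s \<in> diff_coset H (a + b)" for y s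
    using right[OF that] by (intro ex1I[of _ "s - y"]) (auto simp: cayley_table_def)
  ultimately show ?thesis
    unfolding latin_square_def S using fin by (simp add: card_diff_coset finite_diff_coset)
qed

theorem theorem4p6:
  fixes X Y :: "'a::ab_group_add set" and m :: nat and \<alpha> \<beta> :: real
  assumes "m > 0"
    and "finite X" and "finite Y"
    and "real (card X) = \<alpha> * real m" and "real (card Y) = \<beta> * real m"
    and "\<alpha> > 1 / 2" and "\<beta> > 2 / 3"
    and "card (symbols cayley_table X Y) = m"
  shows "\<exists>X' Y'. X \<subseteq> X' \<and> Y \<subseteq> Y' \<and> latin_square m cayley_table X' Y'"
proof -
  let ?C = "symbols cayley_table X Y" and ?H = "differences X"
  have "1 / 2 * real m < \<alpha> * real m" "2 / 3 * real m < \<beta> * real m"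
    using assms by (intro mult_strict_right_mono; simp)+
  then have "real m < 2 * real (card X)" "2 * real m < 3 * real (card Y)"
    unfolding assms(4,5) by linarith+
  then have dense: "card ?C < 2 * card X" "2 * card ?C < 3 * card Y"
    unfolding assms(8) by linarith+
  from dense have "X \<noteq> {}" "Y \<noteq> {}"
    by auto
  then obtain x0 y0 where x0: "x0 \<in> X" and y0: "y0 \<in> Y"
    by blast
  note coset = sumset_is_coset[OF assms(2,3) dense x0 y0]
  have "0 \<in> ?H"
    unfolding differences_def using x0 by force
  then have "latin_square (card ?H) cayley_table (diff_coset ?H x0) (diff_coset ?H y0)"
    using coset(1) finite_differences[OF assms(2)] by (intro latin_square_cosets)
  \<comment> \<open>The order of the square is \<open>m\<close> because \<open>?C\<close> is itself
    a translate of \<open>?H\<close>.\<close>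
  moreover have "card ?H = m"
    using coset(4) assms(8) card_diff_coset[of ?H "x0 + y0"] by simp
  ultimately show ?thesis
    using coset(2,3) by blast
qed

end
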